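(* Let $k$ be a field and $n\ge 4$. The category $\check{\mathcal B}$ of representations of $Q(n)$ is equivalent to the category $\mathrm{Rep}\,Q(n-1)$ of all representations of $Q(n-1)$. More precisely, $\check{\mathcal B}$ is the (essential) image of the fully faithful functor $\eta:\mathrm{Rep}\,Q(n-1)\to \mathrm{Rep}\,Q(n)$ which sends a representation $M$ of $Q(n-1)$ with maps $\pi_1: M_3\to M_1$, $\pi_2: M_3\to M_2$ and $M_{i+1}\to M_i$ ($3\le i\le n-2$) to the representation $\eta(M)$ with $\eta(M)_1=M_1$, $\eta(M)_2=M_2$, $\eta(M)_3=M_1\oplus M_2$, $\eta(M)_{i}=M_{i-1}$ for $4\le i\le n$, whose maps are: the canonical projections $\epsilon_j: M_1\oplus M_2\to M_j$ at the arrows $3\to j$ for $j=1,2$; the map $\begin{bmatrix}\pi_1\\ \pi_2\end{bmatrix}: M_3\to M_1\oplus M_2$ at the arrow $4\to 3$; and the given maps $M_{i}\to M_{i-1}$ at the arrows $i+1\to i$ for $4\le i\le n-1$.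
   Context: For $m\ge 3$, $Q(m)$ is the quiver with vertices $1,\dots,m$ and arrows $\pi_1: 3\to 1$, $\pi_2: 3\to 2$, and $i+1\to i$ for $3\le i\le m-1$. $\mathrm{Rep}\,Q(m)$ is the category of all (possibly infinite-dimensional) representations of $Q(m)$ over $k$. $\check{\mathcal B}$ is the full subcategory of $\mathrm{Rep}\,Q(n)$ of all representations $M$ such that $\begin{bmatrix}\pi_1\\ \pi_2\end{bmatrix}: M_3\to M_1\oplus M_2$ is bijective. The functor $\eta$ acts on morphisms in the obvious way: $\eta(f)_1=f_1$, $\eta(f)_2=f_2$, $\eta(f)_3=f_1\oplus f_2$, $\eta(f)_i=f_{i-1}$ for $i\ge 4$. *)

theory Defs
  imports
    "Graph_Theory.Digraph"
    "Jordan_Normal_Form.Missing_VectorSpace"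
begin

section \<open>Categories, functors, equivalences\<close>

text \<open>Hom-sets of distinct pairs of objects need not be disjoint, so composition carries the
  objects involved: for \<open>f : X \<rightarrow> Y\<close> and \<open>g : Y \<rightarrow> Z\<close>, the composite of \<open>g\<close> after \<open>f\<close> is
  \<open>Comp C X Y Z g f\<close>.\<close>

record ('o, 'm) category =
  Ob :: "'o set"
  Hom :: "'o \<Rightarrow> 'o \<Rightarrow> 'm set"
  Id :: "'o \<Rightarrow> 'm"
  Comp :: "'o \<Rightarrow> 'o \<Rightarrow> 'o \<Rightarrow> 'm \<Rightarrow> 'm \<Rightarrow> 'm"

locale category =
  fixes C :: "('o, 'm) category"
  assumes Id_in_Hom: "X \<in> Ob C \<Longrightarrow> Id C X \<in> Hom C X X"
    and Comp_in_Hom: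
      "\<lbrakk>X \<in> Ob C; Y \<in> Ob C; Z \<in> Ob C; f \<in> Hom C X Y; g \<in> Hom C Y Z\<rbrakk>
        \<Longrightarrow> Comp C X Y Z g f \<in> Hom C X Z"
    and Comp_Id_right:
      "\<lbrakk>X \<in> Ob C; Y \<in> Ob C; f \<in> Hom C X Y\<rbrakk> \<Longrightarrow> Comp C X X Y f (Id C X) = f"
    and Comp_Id_left:
      "\<lbrakk>X \<in> Ob C; Y \<in> Ob C; f \<in> Hom C X Y\<rbrakk> \<Longrightarrow> Comp C X Y Y (Id C Y) f = f"
    and Comp_assoc:
      "\<lbrakk>W \<in> Ob C; X \<in> Ob C; Y \<in> Ob C; Z \<in> Ob C;
        f \<in> Hom C W X; g \<in> Hom C X Y; h \<in> Hom C Y Z\<rbrakk>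
        \<Longrightarrow> Comp C W Y Z h (Comp C W X Y g f) = Comp C W X Z (Comp C X Y Z h g) f"

definition is_iso :: "('o, 'm) category \<Rightarrow> 'o \<Rightarrow> 'o \<Rightarrow> 'm \<Rightarrow> bool" where
  "is_iso C X Y f \<longleftrightarrow> f \<in> Hom C X Y \<and>
     (\<exists>g\<in>Hom C Y X. Comp C X Y X g f = Id C X \<and> Comp C Y X Y f g = Id C Y)"

definition isomorphic :: "('o, 'm) category \<Rightarrow> 'o \<Rightarrow> 'o \<Rightarrow> bool" where
  "isomorphic C X Y \<longleftrightarrow> (\<exists>f. is_iso C X Y f)"

definition full_subcategory :: "('o, 'm) category \<Rightarrow> 'o set \<Rightarrow> ('o, 'm) category" where
  "full_subcategory C S = C\<lparr>Ob := {X \<in> Ob C. X \<in> S}\<rparr>"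

record ('o, 'm, 'p, 'q) cfunctor =
  ob_map :: "'o \<Rightarrow> 'p"
  mor_map :: "'o \<Rightarrow> 'o \<Rightarrow> 'm \<Rightarrow> 'q"

locale cat_functor = source: category C + target: category D
  for C :: "('o, 'm) category" and D :: "('p, 'q) category" +
  fixes F :: "('o, 'm, 'p, 'q) cfunctor"
  assumes ob_map_in_Ob: "X \<in> Ob C \<Longrightarrow> ob_map F X \<in> Ob D"
    and mor_map_in_Hom:
      "\<lbrakk>X \<in> Ob C; Y \<in> Ob C; f \<in> Hom C X Y\<rbrakk>
        \<Longrightarrow> mor_map F X Y f \<in> Hom D (ob_map F X) (ob_map F Y)"
    and mor_map_Id: "X \<in> Ob C \<Longrightarrow> mor_map F X X (Id C X) = Id D (ob_map F X)"
    and mor_map_Comp: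
      "\<lbrakk>X \<in> Ob C; Y \<in> Ob C; Z \<in> Ob C; f \<in> Hom C X Y; g \<in> Hom C Y Z\<rbrakk>
        \<Longrightarrow> mor_map F X Z (Comp C X Y Z g f) =
            Comp D (ob_map F X) (ob_map F Y) (ob_map F Z) (mor_map F Y Z g) (mor_map F X Y f)"

definition id_functor :: "('o, 'm, 'o, 'm) cfunctor" where
  "id_functor = \<lparr>ob_map = (\<lambda>X. X), mor_map = (\<lambda>X Y f. f)\<rparr>"

definition comp_functor ::
  "('p, 'q, 'r, 's) cfunctor \<Rightarrow> ('o, 'm, 'p, 'q) cfunctor \<Rightarrow> ('o, 'm, 'r, 's) cfunctor" where
  "comp_functor G F =
     \<lparr>ob_map = (\<lambda>X. ob_map G (ob_map F X)),
      mor_map = (\<lambda>X Y f. mor_map G (ob_map F X) (ob_map F Y) (mor_map F X Y f))\<rparr>"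

definition natural_isomorphism ::
  "('o, 'm) category \<Rightarrow> ('p, 'q) category \<Rightarrow> ('o, 'm, 'p, 'q) cfunctor \<Rightarrow>
   ('o, 'm, 'p, 'q) cfunctor \<Rightarrow> ('o \<Rightarrow> 'q) \<Rightarrow> bool" where
  "natural_isomorphism C D F G t \<longleftrightarrow>
     (\<forall>X\<in>Ob C. is_iso D (ob_map F X) (ob_map G X) (t X)) \<and>
     (\<forall>X\<in>Ob C. \<forall>Y\<in>Ob C. \<forall>f\<in>Hom C X Y.
        Comp D (ob_map F X) (ob_map F Y) (ob_map G Y) (t Y) (mor_map F X Y f) =
        Comp D (ob_map F X) (ob_map G X) (ob_map G Y) (mor_map G X Y f) (t X))"

definition equivalent_categories :: "('o, 'm) category \<Rightarrow> ('p, 'q) category \<Rightarrow> bool" where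
  "equivalent_categories C D \<longleftrightarrow>
     (\<exists>F G. cat_functor C D F \<and> cat_functor D C G \<and>
        (\<exists>s. natural_isomorphism C C id_functor (comp_functor G F) s) \<and>
        (\<exists>t. natural_isomorphism D D (comp_functor F G) id_functor t))"

definition fully_faithful ::
  "('o, 'm) category \<Rightarrow> ('p, 'q) category \<Rightarrow> ('o, 'm, 'p, 'q) cfunctor \<Rightarrow> bool" where
  "fully_faithful C D F \<longleftrightarrow>
     (\<forall>X\<in>Ob C. \<forall>Y\<in>Ob C.
        bij_betw (mor_map F X Y) (Hom C X Y) (Hom D (ob_map F X) (ob_map F Y)))"

definition essential_image ::
  "('o, 'm) category \<Rightarrow> ('p, 'q) category \<Rightarrow> ('o, 'm, 'p, 'q) cfunctor \<Rightarrow>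
   ('p, 'q) category" where
  "essential_image C D F =
     full_subcategory D {Y. \<exists>X\<in>Ob C. isomorphic D (ob_map F X) Y}"


section \<open>Representations of quivers\<close>

text \<open>A quiver is a \<open>pre_digraph\<close>. For a representation \<open>M\<close>, only the values of \<open>rep_map M a\<close>
  on the space at the tail of \<open>a\<close> matter, and only at vertices and arrows of the quiver;
  morphisms, in contrast, are extensional, so that equal morphisms are equal functions.\<close>

record ('v, 'a, 'k, 'w) rep =
  rep_space :: "'v \<Rightarrow> ('k, 'w) module"
  rep_map :: "'a \<Rightarrow> 'w \<Rightarrow> 'w"

definition is_rep ::
  "('k, 'r) ring_scheme \<Rightarrow> ('v, 'a) pre_digraph \<Rightarrow> ('v, 'a, 'k, 'w) rep \<Rightarrow> bool" where
  "is_rep K Q M \<longleftrightarrow>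
     (\<forall>v\<in>verts Q. vectorspace K (rep_space M v)) \<and>
     (\<forall>a\<in>arcs Q.
        rep_map M a \<in> module_hom K (rep_space M (tail Q a)) (rep_space M (head Q a)))"

definition rep_hom ::
  "('k, 'r) ring_scheme \<Rightarrow> ('v, 'a) pre_digraph \<Rightarrow> ('v, 'a, 'k, 'w) rep \<Rightarrow>
   ('v, 'a, 'k, 'w) rep \<Rightarrow> ('v \<Rightarrow> 'w \<Rightarrow> 'w) set" where
  "rep_hom K Q M N =
     {f \<in> (\<Pi>\<^sub>E v\<in>verts Q.
            module_hom K (rep_space M v) (rep_space N v) \<inter> extensional (carrier (rep_space M v))).
        \<forall>a\<in>arcs Q. \<forall>x\<in>carrier (rep_space M (tail Q a)).
          f (head Q a) (rep_map M a x) = rep_map N a (f (tail Q a) x)}"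

definition Rep ::
  "('k, 'r) ring_scheme \<Rightarrow> ('v, 'a) pre_digraph \<Rightarrow>
   (('v, 'a, 'k, 'w) rep, 'v \<Rightarrow> 'w \<Rightarrow> 'w) category" where
  "Rep K Q =
     \<lparr>Ob = {M. is_rep K Q M},
      Hom = rep_hom K Q,
      Id = (\<lambda>M. \<lambda>v\<in>verts Q. \<lambda>x\<in>carrier (rep_space M v). x),
      Comp = (\<lambda>L M N g f. \<lambda>v\<in>verts Q. compose (carrier (rep_space L v)) (g v) (f v))\<rparr>"


section \<open>A universe of vectors closed under pairing\<close>

text \<open>The category of all representations is taken relative to a universe in which the underlying
  sets of the vector spaces live. It has to contain the direct sum of any two of its spaces,
  hence be closed under pairing; \<open>'u univ\<close> is the free such universe over an arbitrary type
  \<open>'u\<close> (an ordinary pair cannot be used, as its type differs from that of its components).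
  Every vector space with carrier in \<open>'u\<close> has a copy in \<open>'u univ\<close> via \<open>Atom\<close>.\<close>

datatype 'u univ = Atom 'u | Tup (untup: "'u univ \<times> 'u univ")

text \<open>The library's direct sum, transported along the injection \<open>Tup\<close>.\<close>

definition dsum ::
  "('k, 'u univ) module \<Rightarrow> ('k, 'u univ) module \<Rightarrow> ('k, 'u univ) module" where
  "dsum V W = (let S = direct_sum V W in
     \<lparr>carrier = Tup ` carrier S,
      mult = (\<lambda>x y. Tup (untup x \<otimes>\<^bsub>S\<^esub> untup y)),
      one = Tup \<one>\<^bsub>S\<^esub>,
      zero = Tup \<zero>\<^bsub>S\<^esub>,
      add = (\<lambda>x y. Tup (untup x \<oplus>\<^bsub>S\<^esub> untup y)),
      smult = (\<lambda>c x. Tup (c \<odot>\<^bsub>S\<^esub> untup x))\<rparr>)"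

definition proj1 :: "'u univ \<Rightarrow> 'u univ" where
  "proj1 z = fst (untup z)"

definition proj2 :: "'u univ \<Rightarrow> 'u univ" where
  "proj2 z = snd (untup z)"

definition col_map :: "('w \<Rightarrow> 'u univ) \<Rightarrow> ('w \<Rightarrow> 'u univ) \<Rightarrow> 'w \<Rightarrow> 'u univ" where
  "col_map p q x = Tup (p x, q x)"

definition oplus_map ::
  "('u univ \<Rightarrow> 'u univ) \<Rightarrow> ('u univ \<Rightarrow> 'u univ) \<Rightarrow> 'u univ \<Rightarrow> 'u univ" where
  "oplus_map f g z = Tup (f (proj1 z), g (proj2 z))"


section \<open>The quivers $Q(m)$, the category $\check{\mathcal B}$ and the functor $\eta$\<close>

text \<open>An arrow \<open>i \<rightarrow> j\<close> of \<open>Q m\<close> is the pair \<open>(i, j)\<close>.\<close>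

definition Q :: "nat \<Rightarrow> (nat, nat \<times> nat) pre_digraph" where
  "Q m = \<lparr>verts = {1..m},
          arcs = {(3, 1), (3, 2)} \<union> {(i + 1, i) | i. 3 \<le> i \<and> i \<le> m - 1},
          tail = fst, head = snd\<rparr>"

type_synonym ('k, 'u) Qrep = "(nat, nat \<times> nat, 'k, 'u univ) rep"

type_synonym ('k, 'u) RepQ = "(('k, 'u) Qrep, nat \<Rightarrow> 'u univ \<Rightarrow> 'u univ) category"

definition B_check :: "('k, 'r) ring_scheme \<Rightarrow> nat \<Rightarrow> ('k, 'u) RepQ" where
  "B_check K n = full_subcategory (Rep K (Q n))
     {M. bij_betw (col_map (rep_map M (3, 1)) (rep_map M (3, 2)))
           (carrier (rep_space M 3))
           (carrier (dsum (rep_space M 1) (rep_space M 2)))}"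

definition eta_ob :: "('k, 'u) Qrep \<Rightarrow> ('k, 'u) Qrep" where
  "eta_ob M =
     \<lparr>rep_space = (\<lambda>i.
        if i = 1 then rep_space M 1
        else if i = 2 then rep_space M 2
        else if i = 3 then dsum (rep_space M 1) (rep_space M 2)
        else rep_space M (i - 1)),
      rep_map = (\<lambda>(i, j).
        if (i, j) = (3, 1) then proj1
        else if (i, j) = (3, 2) then proj2
        else if (i, j) = (4, 3) then col_map (rep_map M (3, 1)) (rep_map M (3, 2))
        else rep_map M (i - 1, j - 1))\<rparr>"

definition eta_mor ::
  "nat \<Rightarrow> ('k, 'u) Qrep \<Rightarrow> ('k, 'u) Qrep \<Rightarrow> (nat \<Rightarrow> 'u univ \<Rightarrow> 'u univ) \<Rightarrow>
   nat \<Rightarrow> 'u univ \<Rightarrow> 'u univ" where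
  "eta_mor n M N f = (\<lambda>i\<in>{1..n}.
     if i = 1 then f 1
     else if i = 2 then f 2
     else if i = 3 then
       restrict (oplus_map (f 1) (f 2)) (carrier (dsum (rep_space M 1) (rep_space M 2)))
     else f (i - 1))"

definition eta ::
  "nat \<Rightarrow> (('k, 'u) Qrep, nat \<Rightarrow> 'u univ \<Rightarrow> 'u univ,
           ('k, 'u) Qrep, nat \<Rightarrow> 'u univ \<Rightarrow> 'u univ) cfunctor" where
  "eta n = \<lparr>ob_map = eta_ob, mor_map = eta_mor n\<rparr>"

end

theory Submission
  imports Defs
begin

text \<open>
  A representation of \<open>Q n\<close> lies in \<open>B_check\<close> exactly when its vertex 3 is, up to
  a unique isomorphism compatible with the projections, the direct sum of the spaces at 1 and 2.
  The space at 3 and the two maps leaving it are then redundant, and a map into vertex 3 is the same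
  thing as a pair of maps into the vertices 1 and 2. Forgetting the vertex 3 and renumbering the
  vertices above it leaves a representation of \<open>Q (n - 1)\<close>, and \<open>\<eta>\<close> restores
  what was forgotten.

  This is made precise as follows. The functor \<open>\<eta>\<close> is fully faithful because a morphism
  \<open>g\<close> between two representations in its image is forced to be \<open>g\<^sub>1 \<oplus> g\<^sub>2\<close> at
  vertex 3, by compatibility with the projections; the remaining components are free, and
  compatibility with the arrow \<open>4 \<rightarrow> 3\<close> amounts to compatibility with the two arrows
  \<open>3 \<rightarrow> 1\<close> and \<open>3 \<rightarrow> 2\<close> of the smaller quiver (\<open>fully_faithful_eta\<close>).
  If the column map of \<open>M\<close> is bijective, it is itself, together with identities elsewhere, an
  isomorphism from \<open>M\<close> to \<open>\<eta>\<close> of the contracted representation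
  (\<open>isomorphic_eta_contract\<close>). Conversely, bijectivity of the column map holds in the image of
  \<open>\<eta>\<close>, where the column map is the identity, and is invariant under isomorphism
  (\<open>bij_col_map_of_isomorphic_eta\<close>). So \<open>B_check\<close> is the essential image.

  The equivalence then needs no inverse functor built by hand: any fully faithful functor is an
  equivalence onto its essential image (\<open>fully_faithful_equivalent_essential_image\<close>).
\<close>

section \<open>Full faithfulness and essential images\<close>

lemma isomorphic_sym: "isomorphic C X Y \<Longrightarrow> isomorphic C Y X"
  unfolding isomorphic_def is_iso_def by blast

lemma full_subcategory_simps [simp]:
  "Ob (full_subcategory C S) = {X \<in> Ob C. X \<in> S}"
  "Hom (full_subcategory C S) = Hom C"
  "Id (full_subcategory C S) = Id C"
  "Comp (full_subcategory C S) = Comp C"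
  unfolding full_subcategory_def by simp_all

lemma is_iso_full_subcategory [simp]: "is_iso (full_subcategory C S) = is_iso C"
  unfolding is_iso_def fun_eq_iff by simp

lemma (in category) category_full_subcategory: "category (full_subcategory C S)"
  by unfold_locales
    (simp_all add: Id_in_Hom Comp_in_Hom Comp_Id_right Comp_Id_left Comp_assoc)

context cat_functor
begin

lemma fully_faithful_cancel:
  assumes "fully_faithful C D F" "X \<in> Ob C" "Y \<in> Ob C" "f \<in> Hom C X Y" "g \<in> Hom C X Y"
    and "mor_map F X Y f = mor_map F X Y g"
  shows "f = g"
  using assms unfolding fully_faithful_def bij_betw_def inj_on_def by blast

lemma fully_faithful_reflects_iso:
  assumes ff: "fully_faithful C D F" and X: "X \<in> Ob C" and Y: "Y \<in> Ob C"
    and f: "f \<in> Hom C X Y" and iso: "is_iso D (ob_map F X) (ob_map F Y) (mor_map F X Y f)"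
  shows "is_iso C X Y f"
proof -
  obtain h where h: "h \<in> Hom D (ob_map F Y) (ob_map F X)"
    and hf: "Comp D (ob_map F X) (ob_map F Y) (ob_map F X) h (mor_map F X Y f) = Id D (ob_map F X)"
    and fh: "Comp D (ob_map F Y) (ob_map F X) (ob_map F Y) (mor_map F X Y f) h = Id D (ob_map F Y)"
    using iso unfolding is_iso_def by blast
  obtain g where g: "g \<in> Hom C Y X" and h_eq: "h = mor_map F Y X g"
    using ff X Y h unfolding fully_faithful_def bij_betw_def by blast
  have "Comp C X Y X g f = Id C X"
    by (rule fully_faithful_cancel[OF ff X X])
      (use X Y f g hf h_eq in \<open>simp_all add: source.Comp_in_Hom source.Id_in_Hom mor_map_Comp mor_map_Id\<close>)
  moreover have "Comp C Y X Y f g = Id C Y"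
    by (rule fully_faithful_cancel[OF ff Y Y])
      (use X Y f g fh h_eq in \<open>simp_all add: source.Comp_in_Hom source.Id_in_Hom mor_map_Comp mor_map_Id\<close>)
  ultimately show ?thesis
    using f g unfolding is_iso_def by blast
qed

text \<open>The quasi-inverse \<open>G\<close> chooses for every object \<open>Y\<close> of the essential image an
  object \<open>P Y\<close> of \<open>C\<close> and mutually inverse \<open>u Y : F (P Y) \<rightarrow> Y\<close> and
  \<open>v Y : Y \<rightarrow> F (P Y)\<close>. It sends \<open>f : Y \<rightarrow> Z\<close> to the morphism whose image
  under \<open>F\<close> is the conjugate \<open>v Z \<circ> f \<circ> u Y\<close>. Conjugation is functorial and makes
  \<open>v\<close> natural. Every identity required in \<open>C\<close> holds because it holds after applying the
  faithful functor \<open>F\<close>; in particular the lift of \<open>u\<close> along \<open>F\<close> is the other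
  natural isomorphism.\<close>

lemma fully_faithful_equivalent_essential_image:
  assumes ff: "fully_faithful C D F"
  shows "equivalent_categories (essential_image C D F) C"
proof -
  let ?E = "essential_image C D F"
  have E_simps: "Ob ?E = {Y \<in> Ob D. \<exists>X\<in>Ob C. isomorphic D (ob_map F X) Y}"
    "Hom ?E = Hom D" "Id ?E = Id D" "Comp ?E = Comp D" "is_iso ?E = is_iso D"
    unfolding essential_image_def by simp_all
  have catE: "category ?E"
    unfolding essential_image_def by (rule target.category_full_subcategory)
  have "\<forall>Y\<in>Ob ?E. \<exists>X u v. X \<in> Ob C \<and> u \<in> Hom D (ob_map F X) Y \<and> v \<in> Hom D Y (ob_map F X) \<and>
      Comp D (ob_map F X) Y (ob_map F X) v u = Id D (ob_map F X) \<and>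
      Comp D Y (ob_map F X) Y u v = Id D Y"
    unfolding E_simps isomorphic_def is_iso_def by blast
  then obtain P u v where
    P: "\<And>Y. Y \<in> Ob ?E \<Longrightarrow> P Y \<in> Ob C" and
    u: "\<And>Y. Y \<in> Ob ?E \<Longrightarrow> u Y \<in> Hom D (ob_map F (P Y)) Y" and
    v: "\<And>Y. Y \<in> Ob ?E \<Longrightarrow> v Y \<in> Hom D Y (ob_map F (P Y))" and
    vu: "\<And>Y. Y \<in> Ob ?E \<Longrightarrow> Comp D (ob_map F (P Y)) Y (ob_map F (P Y)) (v Y) (u Y) = Id D (ob_map F (P Y))" and
    uv: "\<And>Y. Y \<in> Ob ?E \<Longrightarrow> Comp D Y (ob_map F (P Y)) Y (u Y) (v Y) = Id D Y"
    by metis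
  have ED: "\<And>Y. Y \<in> Ob ?E \<Longrightarrow> Y \<in> Ob D"
    unfolding E_simps by blast
  have FE: "ob_map F X \<in> Ob ?E" if "X \<in> Ob C" for X
  proof -
    have "is_iso D (ob_map F X) (ob_map F X) (Id D (ob_map F X))"
      unfolding is_iso_def using that
      by (auto simp: target.Id_in_Hom target.Comp_Id_left ob_map_in_Ob intro!: bexI[of _ "Id D (ob_map F X)"])
    then show ?thesis
      using that ob_map_in_Ob unfolding E_simps isomorphic_def by blast
  qed
  note FP = ob_map_in_Ob[OF P]
  define conj where "conj Y Z f =
    Comp D (ob_map F (P Y)) Z (ob_map F (P Z)) (v Z) (Comp D (ob_map F (P Y)) Y Z f (u Y))" for Y Z f
  have conj_in: "conj Y Z f \<in> Hom D (ob_map F (P Y)) (ob_map F (P Z))"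
    if "Y \<in> Ob ?E" "Z \<in> Ob ?E" "f \<in> Hom D Y Z" for Y Z f
    unfolding conj_def using that by (intro target.Comp_in_Hom) (auto simp: ED FP u v)
  have lift: "\<exists>g\<in>Hom C X Y. mor_map F X Y g = h"
    if "X \<in> Ob C" "Y \<in> Ob C" "h \<in> Hom D (ob_map F X) (ob_map F Y)" for X Y h
    using ff that unfolding fully_faithful_def bij_betw_def by (metis (no_types, lifting) imageE)
  define G where "G = \<lparr>ob_map = P, mor_map = (\<lambda>Y Z f. SOME g. g \<in> Hom C (P Y) (P Z) \<and>
      mor_map F (P Y) (P Z) g = conj Y Z f)\<rparr>"
  have G_ob [simp]: "ob_map G = P"
    unfolding G_def by simp
  have G_mor: "mor_map G Y Z f \<in> Hom C (P Y) (P Z) \<and> mor_map F (P Y) (P Z) (mor_map G Y Z f) = conj Y Z f"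
    if "Y \<in> Ob ?E" "Z \<in> Ob ?E" "f \<in> Hom D Y Z" for Y Z f
  proof -
    have "\<exists>g. g \<in> Hom C (P Y) (P Z) \<and> mor_map F (P Y) (P Z) g = conj Y Z f"
      using lift[OF P P conj_in] that by blast
    then show ?thesis
      unfolding G_def by simp (rule someI_ex)
  qed
  have conj_Id: "conj Y Y (Id D Y) = Id D (ob_map F (P Y))" if "Y \<in> Ob ?E" for Y
    unfolding conj_def using that by (simp add: target.Comp_Id_left FP ED u vu)
  (* Between the two conjugates, u Y after v Y cancels. *)
  have conj_Comp: "conj X Z (Comp D X Y Z g f) =
      Comp D (ob_map F (P X)) (ob_map F (P Y)) (ob_map F (P Z)) (conj Y Z g) (conj X Y f)"
    if X: "X \<in> Ob ?E" and Y: "Y \<in> Ob ?E" and Z: "Z \<in> Ob ?E"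
      and f: "f \<in> Hom D X Y" and g: "g \<in> Hom D Y Z" for X Y Z f g
  proof -
    let ?X = "ob_map F (P X)" and ?Y = "ob_map F (P Y)" and ?Z = "ob_map F (P Z)"
    have obs: "X \<in> Ob D" "Y \<in> Ob D" "Z \<in> Ob D" "?X \<in> Ob D" "?Y \<in> Ob D" "?Z \<in> Ob D"
      using X Y Z ED FP by auto
    have fu: "Comp D ?X X Y f (u X) \<in> Hom D ?X Y"
      using obs f u[OF X] by (blast intro: target.Comp_in_Hom)
    have gu: "Comp D ?Y Y Z g (u Y) \<in> Hom D ?Y Z"
      using obs g u[OF Y] by (blast intro: target.Comp_in_Hom)
    have "Comp D ?X ?Y ?Z (conj Y Z g) (conj X Y f) =
        Comp D ?X Z ?Z (v Z) (Comp D ?X ?Y Z (Comp D ?Y Y Z g (u Y)) (conj X Y f))"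
      using obs gu conj_in[OF X Y f] v[OF Z] unfolding conj_def[of Y Z]
      by (simp add: target.Comp_assoc)
    also have "Comp D ?X ?Y Z (Comp D ?Y Y Z g (u Y)) (conj X Y f) =
        Comp D ?X Y Z g (Comp D ?X ?Y Y (u Y) (conj X Y f))"
      using obs g u[OF Y] conj_in[OF X Y f] by (simp add: target.Comp_assoc)
    also have "Comp D ?X ?Y Y (u Y) (conj X Y f) = Comp D ?X X Y f (u X)"
      unfolding conj_def using obs fu u[OF Y] v[OF Y] uv[OF Y]
      by (simp add: target.Comp_assoc target.Comp_Id_left)
    also have "Comp D ?X Y Z g (Comp D ?X X Y f (u X)) = Comp D ?X X Z (Comp D X Y Z g f) (u X)"
      using obs f g u[OF X] by (simp add: target.Comp_assoc)
    finally show ?thesis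
      unfolding conj_def[of X Z] by simp
  qed
  have functor_G: "cat_functor ?E C G"
  proof (intro cat_functor.intro cat_functor_axioms.intro catE source.category_axioms,
      goal_cases ob mor Id Comp)
    case (ob X)
    then show ?case by (simp add: P)
  next
    case (mor X Y f)
    then show ?case using G_mor by (simp add: E_simps)
  next
    case (Id X)
    then have "Id D X \<in> Hom D X X"
      by (simp add: ED target.Id_in_Hom)
    with Id show ?case
      using fully_faithful_cancel[OF ff P P] G_mor
      by (simp add: E_simps(2-) conj_Id mor_map_Id P source.Id_in_Hom)
  next
    case (Comp X Y Z f g)
    then have fg: "f \<in> Hom D X Y" "g \<in> Hom D Y Z" "Comp D X Y Z g f \<in> Hom D X Z"
      by (auto simp: E_simps(2-) ED intro: target.Comp_in_Hom)
    have "Comp C (P X) (P Y) (P Z) (mor_map G Y Z g) (mor_map G X Y f) \<in> Hom C (P X) (P Z)"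
      using Comp fg G_mor P by (blast intro: source.Comp_in_Hom)
    then show ?case
      using Comp fg G_mor fully_faithful_cancel[OF ff P P]
      by (simp add: E_simps(2-) conj_Comp mor_map_Comp P)
  qed
  have functor_F: "cat_functor C ?E F"
    by (intro cat_functor.intro cat_functor_axioms.intro catE source.category_axioms)
      (auto simp: E_simps(2-) FE mor_map_in_Hom mor_map_Id mor_map_Comp)
  have unit: "natural_isomorphism ?E ?E id_functor (comp_functor F G) v"
    unfolding natural_isomorphism_def
  proof (intro conjI ballI)
    fix X assume X: "X \<in> Ob ?E"
    show "is_iso ?E (ob_map id_functor X) (ob_map (comp_functor F G) X) (v X)"
      using u[OF X] v[OF X] uv[OF X] vu[OF X]
      by (auto simp: id_functor_def comp_functor_def E_simps(5) is_iso_def)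
  next
    fix X Y f assume X: "X \<in> Ob ?E" and Y: "Y \<in> Ob ?E" and "f \<in> Hom ?E X Y"
    then have f: "f \<in> Hom D X Y"
      by (simp add: E_simps(2))
    have obs: "X \<in> Ob D" "Y \<in> Ob D" "ob_map F (P X) \<in> Ob D" "ob_map F (P Y) \<in> Ob D"
      using X Y ED FP by auto
    have fu: "Comp D (ob_map F (P X)) X Y f (u X) \<in> Hom D (ob_map F (P X)) Y"
      using obs f u[OF X] by (blast intro: target.Comp_in_Hom)
    have "Comp D X (ob_map F (P X)) (ob_map F (P Y)) (conj X Y f) (v X) =
        Comp D X Y (ob_map F (P Y)) (v Y)
          (Comp D X (ob_map F (P X)) Y (Comp D (ob_map F (P X)) X Y f (u X)) (v X))"
      unfolding conj_def using obs fu v[OF X] v[OF Y] by (simp add: target.Comp_assoc)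
    also have "Comp D X (ob_map F (P X)) Y (Comp D (ob_map F (P X)) X Y f (u X)) (v X) = f"
      using obs f u[OF X] v[OF X] uv[OF X]
      by (simp add: target.Comp_assoc[symmetric] target.Comp_Id_right)
    finally show "Comp ?E (ob_map id_functor X) (ob_map id_functor Y) (ob_map (comp_functor F G) Y)
        (v Y) (mor_map id_functor X Y f) =
      Comp ?E (ob_map id_functor X) (ob_map (comp_functor F G) X) (ob_map (comp_functor F G) Y)
        (mor_map (comp_functor F G) X Y f) (v X)"
      using G_mor[OF X Y f] by (simp add: id_functor_def comp_functor_def E_simps(4))
  qed
  have "\<forall>X\<in>Ob C. \<exists>g. g \<in> Hom C (P (ob_map F X)) X \<and>
      mor_map F (P (ob_map F X)) X g = u (ob_map F X)"
    using lift P FE u by blast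
  then obtain t where t: "\<And>X. X \<in> Ob C \<Longrightarrow> t X \<in> Hom C (P (ob_map F X)) X"
    and Ft: "\<And>X. X \<in> Ob C \<Longrightarrow> mor_map F (P (ob_map F X)) X (t X) = u (ob_map F X)"
    by metis
  have counit: "natural_isomorphism C C (comp_functor G F) id_functor t"
    unfolding natural_isomorphism_def
  proof (intro conjI ballI)
    fix X assume X: "X \<in> Ob C"
    note X' = FE[OF X]
    have "is_iso C (P (ob_map F X)) X (t X)"
      by (rule fully_faithful_reflects_iso[OF ff P[OF X'] X t[OF X]])
        (use u[OF X'] v[OF X'] uv[OF X'] vu[OF X'] Ft[OF X] in \<open>auto simp: is_iso_def\<close>)
    then show "is_iso C (ob_map (comp_functor G F) X) (ob_map id_functor X) (t X)"
      by (simp add: id_functor_def comp_functor_def)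
  next
    fix X Y f assume X: "X \<in> Ob C" and Y: "Y \<in> Ob C" and f: "f \<in> Hom C X Y"
    let ?X = "ob_map F X" and ?Y = "ob_map F Y"
    let ?Gf = "mor_map G ?X ?Y (mor_map F X Y f)"
    note X' = FE[OF X] and Y' = FE[OF Y]
    have Ff: "mor_map F X Y f \<in> Hom D ?X ?Y"
      using X Y f by (rule mor_map_in_Hom)
    have obs: "?X \<in> Ob D" "?Y \<in> Ob D" "ob_map F (P ?X) \<in> Ob D" "ob_map F (P ?Y) \<in> Ob D"
      using X' Y' ED FP by auto
    have Ffu: "Comp D (ob_map F (P ?X)) ?X ?Y (mor_map F X Y f) (u ?X) \<in> Hom D (ob_map F (P ?X)) ?Y"
      using obs Ff u[OF X'] by (blast intro: target.Comp_in_Hom)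
    have Gf: "?Gf \<in> Hom C (P ?X) (P ?Y)" and FGf: "mor_map F (P ?X) (P ?Y) ?Gf = conj ?X ?Y (mor_map F X Y f)"
      using G_mor[OF X' Y' Ff] by auto
    have "Comp C (P ?X) (P ?Y) Y (t Y) ?Gf = Comp C (P ?X) X Y f (t X)"
    proof (rule fully_faithful_cancel[OF ff P[OF X'] Y])
      show "Comp C (P ?X) (P ?Y) Y (t Y) ?Gf \<in> Hom C (P ?X) Y"
        using X Y X' Y' P Gf t by (blast intro: source.Comp_in_Hom)
      show "Comp C (P ?X) X Y f (t X) \<in> Hom C (P ?X) Y"
        using X Y X' P f t by (blast intro: source.Comp_in_Hom)
      have "Comp D (ob_map F (P ?X)) (ob_map F (P ?Y)) ?Y (u ?Y) (conj ?X ?Y (mor_map F X Y f)) =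
          Comp D (ob_map F (P ?X)) ?X ?Y (mor_map F X Y f) (u ?X)"
        unfolding conj_def using obs Ffu u[OF Y'] v[OF Y'] uv[OF Y']
        by (simp add: target.Comp_assoc target.Comp_Id_left)
      then show "mor_map F (P ?X) Y (Comp C (P ?X) (P ?Y) Y (t Y) ?Gf) =
          mor_map F (P ?X) Y (Comp C (P ?X) X Y f (t X))"
        using X Y X' Y' f Gf t by (simp add: mor_map_Comp P FGf Ft)
    qed
    then show "Comp C (ob_map (comp_functor G F) X) (ob_map (comp_functor G F) Y) (ob_map id_functor Y)
        (t Y) (mor_map (comp_functor G F) X Y f) =
      Comp C (ob_map (comp_functor G F) X) (ob_map id_functor X) (ob_map id_functor Y)
        (mor_map id_functor X Y f) (t X)"
      by (simp add: id_functor_def comp_functor_def)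
  qed
  show ?thesis
    unfolding equivalent_categories_def using functor_G functor_F unit counit by blast
qed

end


section \<open>The category of representations of a quiver\<close>

lemma module_homI:
  assumes "\<And>x. x \<in> carrier V \<Longrightarrow> f x \<in> carrier W"
    and "\<And>x y. x \<in> carrier V \<Longrightarrow> y \<in> carrier V \<Longrightarrow> f (x \<oplus>\<^bsub>V\<^esub> y) = f x \<oplus>\<^bsub>W\<^esub> f y"
    and "\<And>c x. c \<in> carrier K \<Longrightarrow> x \<in> carrier V \<Longrightarrow> f (c \<odot>\<^bsub>V\<^esub> x) = c \<odot>\<^bsub>W\<^esub> f x"
  shows "f \<in> module_hom K V W"
  using assms unfolding module_hom_def by auto

lemma module_hom_in_carrier: "f \<in> module_hom K V W \<Longrightarrow> x \<in> carrier V \<Longrightarrow> f x \<in> carrier W"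
  using module_hom_closed by blast

lemma vectorspace_add_closed:
  "vectorspace K V \<Longrightarrow> x \<in> carrier V \<Longrightarrow> y \<in> carrier V \<Longrightarrow> x \<oplus>\<^bsub>V\<^esub> y \<in> carrier V"
  unfolding vectorspace_def module_def by (blast intro: abelian_groupE(1))

lemma vectorspace_smult_closed:
  "vectorspace K V \<Longrightarrow> c \<in> carrier K \<Longrightarrow> x \<in> carrier V \<Longrightarrow> c \<odot>\<^bsub>V\<^esub> x \<in> carrier V"
  unfolding vectorspace_def by (blast intro: module.smult_closed)

lemmas vectorspace_closed = vectorspace_add_closed vectorspace_smult_closed

lemma module_hom_cong:
  assumes "vectorspace K V" "f \<in> module_hom K V W" "\<And>x. x \<in> carrier V \<Longrightarrow> g x = f x"
  shows "g \<in> module_hom K V W"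
  by (rule module_homI)
    (use assms in \<open>auto simp: vectorspace_closed module_hom_add module_hom_smult intro: module_hom_in_carrier\<close>)

lemma module_hom_comp:
  assumes "f \<in> module_hom K U V" "g \<in> module_hom K V W"
  shows "(\<lambda>x. g (f x)) \<in> module_hom K U W"
  by (rule module_homI)
    (use assms in \<open>auto simp: module_hom_in_carrier module_hom_add module_hom_smult\<close>)

lemma module_hom_id: "(\<lambda>x. x) \<in> module_hom K V V"
  by (rule module_homI) auto

lemma module_hom_inv_into:
  assumes V: "vectorspace K V" and f: "f \<in> module_hom K V W"
    and bij: "bij_betw f (carrier V) (carrier W)"
  shows "inv_into (carrier V) f \<in> module_hom K W V"
proof -
  let ?g = "inv_into (carrier V) f"
  have g: "?g y \<in> carrier V" "f (?g y) = y" if "y \<in> carrier W" for y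
    using bij that by (auto simp: bij_betw_def inv_into_into f_inv_into_f)
  have gf: "?g (f x) = x" if "x \<in> carrier V" for x
    using bij that by (simp add: bij_betw_def)
  show ?thesis
  proof (rule module_homI)
    fix x y assume "x \<in> carrier W" "y \<in> carrier W"
    then show "?g (x \<oplus>\<^bsub>W\<^esub> y) = ?g x \<oplus>\<^bsub>V\<^esub> ?g y"
      using g gf[of "?g x \<oplus>\<^bsub>V\<^esub> ?g y"] V f
      by (simp add: module_hom_add vectorspace_closed)
  next
    fix c x assume "c \<in> carrier K" "x \<in> carrier W"
    then show "?g (c \<odot>\<^bsub>W\<^esub> x) = c \<odot>\<^bsub>V\<^esub> ?g x"
      using g gf[of "c \<odot>\<^bsub>V\<^esub> ?g x"] V f
      by (simp add: module_hom_smult vectorspace_closed)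
  qed (rule g)
qed

lemma is_rep_space: "is_rep K G M \<Longrightarrow> v \<in> verts G \<Longrightarrow> vectorspace K (rep_space M v)"
  unfolding is_rep_def by blast

lemma is_rep_map:
  "is_rep K G M \<Longrightarrow> a \<in> arcs G \<Longrightarrow>
    rep_map M a \<in> module_hom K (rep_space M (tail G a)) (rep_space M (head G a))"
  unfolding is_rep_def by blast

lemma rep_hom_module_hom:
  "f \<in> rep_hom K G M N \<Longrightarrow> v \<in> verts G \<Longrightarrow> f v \<in> module_hom K (rep_space M v) (rep_space N v)"
  unfolding rep_hom_def by auto

lemma rep_hom_in_carrier:
  "f \<in> rep_hom K G M N \<Longrightarrow> v \<in> verts G \<Longrightarrow> x \<in> carrier (rep_space M v) \<Longrightarrow>
    f v x \<in> carrier (rep_space N v)"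
  by (rule module_hom_in_carrier[OF rep_hom_module_hom])

lemma rep_hom_commute:
  "f \<in> rep_hom K G M N \<Longrightarrow> a \<in> arcs G \<Longrightarrow> x \<in> carrier (rep_space M (tail G a)) \<Longrightarrow>
    f (head G a) (rep_map M a x) = rep_map N a (f (tail G a) x)"
  unfolding rep_hom_def by blast

lemma rep_hom_eqI:
  assumes "f \<in> rep_hom K G M N" "g \<in> rep_hom K G M N"
    and "\<And>v x. v \<in> verts G \<Longrightarrow> x \<in> carrier (rep_space M v) \<Longrightarrow> f v x = g v x"
  shows "f = g"
proof (rule PiE_ext)
  show "f \<in> (\<Pi>\<^sub>E v\<in>verts G. module_hom K (rep_space M v) (rep_space N v) \<inter> extensional (carrier (rep_space M v)))"
    "g \<in> (\<Pi>\<^sub>E v\<in>verts G. module_hom K (rep_space M v) (rep_space N v) \<inter> extensional (carrier (rep_space M v)))"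
    using assms(1,2) unfolding rep_hom_def by auto
  fix v assume v: "v \<in> verts G"
  show "f v = g v"
    by (rule extensionalityI[of _ "carrier (rep_space M v)"])
      (use assms v in \<open>auto simp: rep_hom_def\<close>)
qed

text \<open>Morphisms are extensional at two levels, in the vertex and in the vector, so a family of
  linear maps has to be restricted twice to become one.\<close>

lemma rep_homI:
  assumes G: "wf_digraph G" and M: "is_rep K G M"
    and hom: "\<And>v. v \<in> verts G \<Longrightarrow> f v \<in> module_hom K (rep_space M v) (rep_space N v)"
    and commute: "\<And>a x. a \<in> arcs G \<Longrightarrow> x \<in> carrier (rep_space M (tail G a)) \<Longrightarrow>
      f (head G a) (rep_map M a x) = rep_map N a (f (tail G a) x)"
  shows "(\<lambda>v\<in>verts G. \<lambda>x\<in>carrier (rep_space M v). f v x) \<in> rep_hom K G M N"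
proof -
  have "restrict (f v) (carrier (rep_space M v)) \<in> module_hom K (rep_space M v) (rep_space N v)"
    if "v \<in> verts G" for v
    by (rule module_hom_cong[OF is_rep_space[OF M that] hom[OF that]]) simp
  moreover have "rep_map M a x \<in> carrier (rep_space M (head G a))"
    if "a \<in> arcs G" "x \<in> carrier (rep_space M (tail G a))" for a x
    using is_rep_map[OF M that(1)] that(2) by (rule module_hom_in_carrier)
  ultimately show ?thesis
    using G commute unfolding rep_hom_def
    by (auto simp: wf_digraph.tail_in_verts wf_digraph.head_in_verts)
qed

lemma Rep_simps [simp]:
  "Ob (Rep K G) = {M. is_rep K G M}"
  "Hom (Rep K G) = rep_hom K G"
  "Id (Rep K G) = (\<lambda>M. \<lambda>v\<in>verts G. \<lambda>x\<in>carrier (rep_space M v). x)"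
  "Comp (Rep K G) = (\<lambda>L M N g f. \<lambda>v\<in>verts G. compose (carrier (rep_space L v)) (g v) (f v))"
  unfolding Rep_def by simp_all

lemma rep_hom_Id:
  assumes "wf_digraph G" "is_rep K G M"
  shows "(\<lambda>v\<in>verts G. \<lambda>x\<in>carrier (rep_space M v). x) \<in> rep_hom K G M M"
  by (rule rep_homI[OF assms]) (auto intro: module_hom_id)

lemma rep_hom_Comp:
  assumes "wf_digraph G" "is_rep K G L" "f \<in> rep_hom K G L M" "g \<in> rep_hom K G M N"
  shows "(\<lambda>v\<in>verts G. compose (carrier (rep_space L v)) (g v) (f v)) \<in> rep_hom K G L N"
  unfolding compose_def
proof (rule rep_homI[OF assms(1,2)])
  fix v assume "v \<in> verts G"
  with assms(3,4) show "(\<lambda>x. g v (f v x)) \<in> module_hom K (rep_space L v) (rep_space N v)"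
    by (blast intro: module_hom_comp rep_hom_module_hom)
next
  fix a x assume "a \<in> arcs G" "x \<in> carrier (rep_space L (tail G a))"
  with assms show "g (head G a) (f (head G a) (rep_map L a x)) =
      rep_map N a (g (tail G a) (f (tail G a) x))"
    by (simp add: rep_hom_commute rep_hom_in_carrier wf_digraph.tail_in_verts)
qed

lemma category_Rep:
  assumes G: "wf_digraph G"
  shows "category (Rep K G)"
proof (unfold_locales, goal_cases)
  case (1 X)
  then show ?case using G by (simp add: rep_hom_Id)
next
  case (2 X Y Z f g)
  then show ?case using G by (simp add: rep_hom_Comp)
next
  case (3 X Y f)
  then have "Comp (Rep K G) X X Y f (Id (Rep K G) X) \<in> rep_hom K G X Y"
    using rep_hom_Comp[OF G _ rep_hom_Id[OF G]] by simp
  with 3 show ?case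
    by (intro rep_hom_eqI) (auto simp: compose_def)
next
  case (4 X Y f)
  then have "Comp (Rep K G) X Y Y (Id (Rep K G) Y) f \<in> rep_hom K G X Y"
    using rep_hom_Comp[OF G _ _ rep_hom_Id[OF G]] by simp
  with 4 show ?case
    by (intro rep_hom_eqI) (auto simp: compose_def rep_hom_in_carrier)
next
  case (5 W X Y Z f g h)
  then show ?case
    by (auto simp: compose_def rep_hom_in_carrier intro!: restrict_ext)
qed

text \<open>As for vector spaces, the inverse of a vertexwise bijective morphism is automatically
  linear and compatible with the arrows. Isomorphy is thus a statement about bijections, which is
  how the condition defining \<open>B_check\<close> is phrased.\<close>

lemma is_iso_Rep_iff:
  assumes G: "wf_digraph G" and M: "is_rep K G M" and N: "is_rep K G N"
  shows "is_iso (Rep K G) M N f \<longleftrightarrow>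
    f \<in> rep_hom K G M N \<and>
    (\<forall>v\<in>verts G. bij_betw (f v) (carrier (rep_space M v)) (carrier (rep_space N v)))"
    (is "?L \<longleftrightarrow> ?R")
proof
  assume ?L
  then obtain g where f: "f \<in> rep_hom K G M N" and g: "g \<in> rep_hom K G N M"
    and gf: "(\<lambda>v\<in>verts G. compose (carrier (rep_space M v)) (g v) (f v)) =
      (\<lambda>v\<in>verts G. \<lambda>x\<in>carrier (rep_space M v). x)"
    and fg: "(\<lambda>v\<in>verts G. compose (carrier (rep_space N v)) (f v) (g v)) =
      (\<lambda>v\<in>verts G. \<lambda>x\<in>carrier (rep_space N v). x)"
    unfolding is_iso_def by auto
  have "bij_betw (f v) (carrier (rep_space M v)) (carrier (rep_space N v))" if v: "v \<in> verts G" for v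
  proof (rule bij_betw_byWitness[where f' = "g v"])
    show "\<forall>x\<in>carrier (rep_space M v). g v (f v x) = x"
    proof
      fix x assume "x \<in> carrier (rep_space M v)"
      then show "g v (f v x) = x"
        using v fun_cong[OF fun_cong[OF gf, of v], of x] by (simp add: compose_def)
    qed
    show "\<forall>x\<in>carrier (rep_space N v). f v (g v x) = x"
    proof
      fix x assume "x \<in> carrier (rep_space N v)"
      then show "f v (g v x) = x"
        using v fun_cong[OF fun_cong[OF fg, of v], of x] by (simp add: compose_def)
    qed
  qed (use f g v in \<open>auto simp: rep_hom_in_carrier\<close>)
  with f show ?R by blast
next
  assume ?R
  then have f: "f \<in> rep_hom K G M N"
    and bij: "\<And>v. v \<in> verts G \<Longrightarrow> bij_betw (f v) (carrier (rep_space M v)) (carrier (rep_space N v))"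
    by auto
  define h where "h v = inv_into (carrier (rep_space M v)) (f v)" for v
  have h: "h v \<in> module_hom K (rep_space N v) (rep_space M v)" if "v \<in> verts G" for v
    unfolding h_def
    by (rule module_hom_inv_into[OF is_rep_space[OF M that] rep_hom_module_hom[OF f that] bij[OF that]])
  have hf: "h v (f v x) = x" if "v \<in> verts G" "x \<in> carrier (rep_space M v)" for v x
    using bij_betw_inv_into_left[OF bij] that unfolding h_def by blast
  have fh: "f v (h v y) = y" if "v \<in> verts G" "y \<in> carrier (rep_space N v)" for v y
    using bij_betw_inv_into_right[OF bij] that unfolding h_def by blast
  have g: "(\<lambda>v\<in>verts G. \<lambda>y\<in>carrier (rep_space N v). h v y) \<in> rep_hom K G N M" (is "?g \<in> _")
  proof (rule rep_homI[OF G N h])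
    (* Write y as an image under f and use the compatibility of f with the arrow. *)
    fix a y assume a: "a \<in> arcs G" and y: "y \<in> carrier (rep_space N (tail G a))"
    have t: "tail G a \<in> verts G" "head G a \<in> verts G"
      using G a by (auto simp: wf_digraph.tail_in_verts wf_digraph.head_in_verts)
    have x: "h (tail G a) y \<in> carrier (rep_space M (tail G a))"
      using h t y by (blast intro: module_hom_in_carrier)
    have "h (head G a) (rep_map N a y) = h (head G a) (rep_map N a (f (tail G a) (h (tail G a) y)))"
      using fh t y by simp
    also have "\<dots> = h (head G a) (f (head G a) (rep_map M a (h (tail G a) y)))"
      using rep_hom_commute[OF f a x] by simp
    also have "\<dots> = rep_map M a (h (tail G a) y)"
      using hf t x module_hom_in_carrier[OF is_rep_map[OF M a]] by simp
    finally show "h (head G a) (rep_map N a y) = rep_map M a (h (tail G a) y)" .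
  qed
  have "Comp (Rep K G) M N M ?g f = Id (Rep K G) M"
    using f by (auto simp: compose_def hf rep_hom_in_carrier intro!: restrict_ext)
  moreover have "Comp (Rep K G) N M N f ?g = Id (Rep K G) N"
    by (auto simp: compose_def fh intro!: restrict_ext)
  ultimately show ?L
    using f g unfolding is_iso_def Rep_simps(2) by blast
qed


section \<open>Direct sums\<close>

lemma carrier_dsum: "carrier (dsum V W) = {Tup (x, y) |x y. x \<in> carrier V \<and> y \<in> carrier W}"
  unfolding dsum_def direct_sum_def Let_def by auto

lemma dsum_simps [simp]:
  "Tup (x, y) \<in> carrier (dsum V W) \<longleftrightarrow> x \<in> carrier V \<and> y \<in> carrier W"
  "Tup (x, y) \<oplus>\<^bsub>dsum V W\<^esub> Tup (x', y') = Tup (x \<oplus>\<^bsub>V\<^esub> x', y \<oplus>\<^bsub>W\<^esub> y')"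
  "\<zero>\<^bsub>dsum V W\<^esub> = Tup (\<zero>\<^bsub>V\<^esub>, \<zero>\<^bsub>W\<^esub>)"
  "c \<odot>\<^bsub>dsum V W\<^esub> Tup (x, y) = Tup (c \<odot>\<^bsub>V\<^esub> x, c \<odot>\<^bsub>W\<^esub> y)"
  unfolding dsum_def direct_sum_def Let_def by auto

lemma proj_Tup [simp]: "proj1 (Tup (x, y)) = x" "proj2 (Tup (x, y)) = y"
  unfolding proj1_def proj2_def by simp_all

lemma Tup_proj [simp]: "Tup (proj1 z, proj2 z) = z" if "z \<in> carrier (dsum V W)"
  using that by (auto simp: carrier_dsum)

lemma proj_in_carrier:
  "z \<in> carrier (dsum V W) \<Longrightarrow> proj1 z \<in> carrier V"
  "z \<in> carrier (dsum V W) \<Longrightarrow> proj2 z \<in> carrier W"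
  by (auto simp: carrier_dsum)

lemma vectorspace_dsum:
  assumes V: "vectorspace K V" and W: "vectorspace K W"
  shows "vectorspace K (dsum V W)"
proof -
  interpret V: vectorspace K V by (rule V)
  interpret W: vectorspace K W by (rule W)
  have "abelian_group (dsum V W)"
  proof (rule abelian_groupI)
    fix z assume "z \<in> carrier (dsum V W)"
    then obtain x y where z: "z = Tup (x, y)" "x \<in> carrier V" "y \<in> carrier W"
      by (auto simp: carrier_dsum)
    then show "\<exists>z'\<in>carrier (dsum V W). z' \<oplus>\<^bsub>dsum V W\<^esub> z = \<zero>\<^bsub>dsum V W\<^esub>"
      by (intro bexI[of _ "Tup (\<ominus>\<^bsub>V\<^esub> x, \<ominus>\<^bsub>W\<^esub> y)"]) (auto simp: V.M.l_neg W.M.l_neg)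
  qed (auto simp: carrier_dsum V.M.a_ac W.M.a_ac)
  moreover have "module_axioms K (dsum V W)"
    by (rule module_axioms.intro)
      (auto simp: carrier_dsum V.smult_l_distr W.smult_l_distr V.smult_r_distr W.smult_r_distr
        V.smult_assoc1 W.smult_assoc1)
  ultimately show ?thesis
    unfolding vectorspace_def module_def
    using V.field_axioms V.R.cring_axioms by blast
qed

lemma proj_module_hom:
  "proj1 \<in> module_hom K (dsum V W) V" "proj2 \<in> module_hom K (dsum V W) W"
  by (rule module_homI; auto simp: carrier_dsum)+

lemma col_map_module_hom:
  assumes "p \<in> module_hom K U V" "q \<in> module_hom K U W"
  shows "col_map p q \<in> module_hom K U (dsum V W)"
  by (rule module_homI)
    (use assms in \<open>auto simp: col_map_def module_hom_in_carrier module_hom_add module_hom_smult\<close>)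

lemma oplus_map_module_hom:
  assumes "f \<in> module_hom K V V'" "g \<in> module_hom K W W'"
  shows "oplus_map f g \<in> module_hom K (dsum V W) (dsum V' W')"
  by (rule module_homI)
    (use assms in \<open>auto simp: oplus_map_def carrier_dsum module_hom_in_carrier module_hom_add module_hom_smult\<close>)

lemma bij_betw_oplus_map:
  assumes "bij_betw f (carrier V) (carrier V')" "bij_betw g (carrier W) (carrier W')"
  shows "bij_betw (oplus_map f g) (carrier (dsum V W)) (carrier (dsum V' W'))"
proof (rule bij_betw_byWitness[where f' =
      "oplus_map (inv_into (carrier V) f) (inv_into (carrier W) g)"])
qed (use assms in \<open>auto simp: oplus_map_def carrier_dsum bij_betw_inv_into_left
  bij_betw_inv_into_right bij_betwE[OF bij_betw_inv_into] bij_betwE\<close>)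


section \<open>The functor \<open>\<eta>\<close>\<close>

lemma Q_simps [simp]:
  "verts (Q m) = {1..m}" "tail (Q m) = fst" "head (Q m) = snd"
  unfolding Q_def by simp_all

lemma arcs_Q: "arcs (Q m) = {(3, 1), (3, 2)} \<union> (\<lambda>i. (Suc i, i)) ` {3..<m}"
  unfolding Q_def by (auto simp: image_iff)

lemma wf_digraph_Q: "3 \<le> m \<Longrightarrow> wf_digraph (Q m)"
  by unfold_locales (auto simp: arcs_Q)

text \<open>The functor \<open>\<eta>\<close> shifts the vertices from 3 on by one. The next lemmas therefore
  enumerate \<open>Q (m + 1)\<close> by the indices of \<open>Q m\<close>, with vertex 3 and arrow
  \<open>4 \<rightarrow> 3\<close> singled out, so that conditions on a representation of \<open>Q m\<close> and on
  its image under \<open>\<eta>\<close> can be compared index by index.\<close>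

lemma ball_verts_Q:
  fixes m :: nat
  assumes "3 \<le> m"
  shows "(\<forall>v\<in>{1..m}. R v) \<longleftrightarrow> R 1 \<and> R 2 \<and> (\<forall>i\<in>{3..m}. R i)"
proof -
  have "{1..m} = {1, 2} \<union> {3..m}" using assms by auto
  then show ?thesis by auto
qed

lemma ball_verts_Q_Suc:
  fixes m :: nat
  assumes "3 \<le> m"
  shows "(\<forall>v\<in>{1..Suc m}. R v) \<longleftrightarrow> R 1 \<and> R 2 \<and> R 3 \<and> (\<forall>i\<in>{3..m}. R (Suc i))"
proof -
  have eq: "{1..Suc m} = {1, 2, 3} \<union> Suc ` {3..m}"
    unfolding image_Suc_atLeastAtMost using assms by auto
  show ?thesis unfolding eq by blast
qed

lemma ball_arcs_Q:
  "(\<forall>a\<in>arcs (Q m). R a) \<longleftrightarrow> R (3, 1) \<and> R (3, 2) \<and> (\<forall>i\<in>{3..<m}. R (Suc i, i))"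
  by (auto simp: arcs_Q)

lemma ball_arcs_Q_Suc:
  assumes "3 \<le> m"
  shows "(\<forall>a\<in>arcs (Q (Suc m)). R a) \<longleftrightarrow>
    R (3, 1) \<and> R (3, 2) \<and> R (4, 3) \<and> (\<forall>i\<in>{3..<m}. R (Suc (Suc i), Suc i))"
proof -
  have eq: "{3..<Suc m} = insert 3 (Suc ` {3..<m})"
    unfolding image_Suc_atLeastLessThan using assms by auto
  show ?thesis unfolding ball_arcs_Q eq ball_simps by simp
qed

lemma is_rep_Q_iff:
  assumes "3 \<le> m"
  shows "is_rep K (Q m) M \<longleftrightarrow>
    (vectorspace K (rep_space M 1) \<and> vectorspace K (rep_space M 2) \<and>
      (\<forall>i\<in>{3..m}. vectorspace K (rep_space M i))) \<and>
    rep_map M (3, 1) \<in> module_hom K (rep_space M 3) (rep_space M 1) \<and>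
    rep_map M (3, 2) \<in> module_hom K (rep_space M 3) (rep_space M 2) \<and>
    (\<forall>i\<in>{3..<m}. rep_map M (Suc i, i) \<in> module_hom K (rep_space M (Suc i)) (rep_space M i))"
  unfolding is_rep_def Q_simps ball_verts_Q[OF assms] ball_arcs_Q by simp

lemma is_rep_Q_Suc_iff:
  assumes "3 \<le> m"
  shows "is_rep K (Q (Suc m)) M \<longleftrightarrow>
    (vectorspace K (rep_space M 1) \<and> vectorspace K (rep_space M 2) \<and> vectorspace K (rep_space M 3) \<and>
      (\<forall>i\<in>{3..m}. vectorspace K (rep_space M (Suc i)))) \<and>
    rep_map M (3, 1) \<in> module_hom K (rep_space M 3) (rep_space M 1) \<and>
    rep_map M (3, 2) \<in> module_hom K (rep_space M 3) (rep_space M 2) \<and>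
    rep_map M (4, 3) \<in> module_hom K (rep_space M 4) (rep_space M 3) \<and>
    (\<forall>i\<in>{3..<m}. rep_map M (Suc (Suc i), Suc i) \<in>
      module_hom K (rep_space M (Suc (Suc i))) (rep_space M (Suc i)))"
  unfolding is_rep_def Q_simps ball_verts_Q_Suc[OF assms] ball_arcs_Q_Suc[OF assms] by simp

lemma eta_ob_space [simp]:
  "rep_space (eta_ob M) (Suc 0) = rep_space M 1"
  "rep_space (eta_ob M) 2 = rep_space M 2"
  "rep_space (eta_ob M) 3 = dsum (rep_space M 1) (rep_space M 2)"
  "rep_space (eta_ob M) 4 = rep_space M 3"
  "3 \<le> i \<Longrightarrow> rep_space (eta_ob M) (Suc i) = rep_space M i"
  unfolding eta_ob_def by auto

lemma eta_ob_map [simp]: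
  "rep_map (eta_ob M) (3, Suc 0) = proj1"
  "rep_map (eta_ob M) (3, 2) = proj2"
  "rep_map (eta_ob M) (4, 3) = col_map (rep_map M (3, 1)) (rep_map M (3, 2))"
  "3 \<le> i \<Longrightarrow> rep_map (eta_ob M) (Suc (Suc i), Suc i) = rep_map M (Suc i, i)"
  unfolding eta_ob_def by auto

lemma is_rep_eta_ob:
  assumes m: "3 \<le> m" and M: "is_rep K (Q m) M"
  shows "is_rep K (Q (Suc m)) (eta_ob M)"
  using M unfolding is_rep_Q_iff[OF m] is_rep_Q_Suc_iff[OF m]
  by (simp add: vectorspace_dsum proj_module_hom col_map_module_hom)

lemma eta_mor_simps [simp]:
  assumes "3 \<le> m"
  shows "eta_mor (Suc m) M N f (Suc 0) = f 1"
    "eta_mor (Suc m) M N f 2 = f 2"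
    "eta_mor (Suc m) M N f 3 =
      restrict (oplus_map (f 1) (f 2)) (carrier (dsum (rep_space M 1) (rep_space M 2)))"
    "eta_mor (Suc m) M N f 4 = f 3"
    "3 \<le> i \<Longrightarrow> i \<le> m \<Longrightarrow> eta_mor (Suc m) M N f (Suc i) = f i"
  using assms unfolding eta_mor_def by auto

lemma rep_hom_Q_iff:
  assumes m: "3 \<le> m"
  shows "f \<in> rep_hom K (Q m) M N \<longleftrightarrow> f \<in> extensional {1..m} \<and>
    (let L = (\<lambda>v. module_hom K (rep_space M v) (rep_space N v) \<inter> extensional (carrier (rep_space M v)))
     in f 1 \<in> L 1 \<and> f 2 \<in> L 2 \<and> (\<forall>i\<in>{3..m}. f i \<in> L i)) \<and>
    (\<forall>x\<in>carrier (rep_space M 3). f 1 (rep_map M (3, 1) x) = rep_map N (3, 1) (f 3 x)) \<and>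
    (\<forall>x\<in>carrier (rep_space M 3). f 2 (rep_map M (3, 2) x) = rep_map N (3, 2) (f 3 x)) \<and>
    (\<forall>i\<in>{3..<m}. \<forall>x\<in>carrier (rep_space M (Suc i)).
      f i (rep_map M (Suc i, i) x) = rep_map N (Suc i, i) (f (Suc i) x))"
  unfolding rep_hom_def PiE_iff mem_Collect_eq Q_simps ball_verts_Q[OF m] ball_arcs_Q Let_def fst_conv snd_conv
  by auto

lemma rep_hom_Q_Suc_iff:
  assumes m: "3 \<le> m"
  shows "f \<in> rep_hom K (Q (Suc m)) M N \<longleftrightarrow> f \<in> extensional {1..Suc m} \<and>
    (let L = (\<lambda>v. module_hom K (rep_space M v) (rep_space N v) \<inter> extensional (carrier (rep_space M v)))
     in f 1 \<in> L 1 \<and> f 2 \<in> L 2 \<and> f 3 \<in> L 3 \<and> (\<forall>i\<in>{3..m}. f (Suc i) \<in> L (Suc i))) \<and>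
    (\<forall>x\<in>carrier (rep_space M 3). f 1 (rep_map M (3, 1) x) = rep_map N (3, 1) (f 3 x)) \<and>
    (\<forall>x\<in>carrier (rep_space M 3). f 2 (rep_map M (3, 2) x) = rep_map N (3, 2) (f 3 x)) \<and>
    (\<forall>x\<in>carrier (rep_space M 4). f 3 (rep_map M (4, 3) x) = rep_map N (4, 3) (f 4 x)) \<and>
    (\<forall>i\<in>{3..<m}. \<forall>x\<in>carrier (rep_space M (Suc (Suc i))).
      f (Suc i) (rep_map M (Suc (Suc i), Suc i) x) = rep_map N (Suc (Suc i), Suc i) (f (Suc (Suc i)) x))"
  unfolding rep_hom_def PiE_iff mem_Collect_eq Q_simps ball_verts_Q_Suc[OF m] ball_arcs_Q_Suc[OF m]
    Let_def fst_conv snd_conv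
  by auto

text \<open>At the arrow \<open>4 \<rightarrow> 3\<close>, compatibility of \<open>\<eta> f\<close> is compatibility of
  \<open>f\<close> with \<open>3 \<rightarrow> 1\<close> and \<open>3 \<rightarrow> 2\<close>, one in each summand. The vectors
  in the image of \<open>M\<^sub>3\<close> have to be known to lie in the direct sum, since outside of it the
  restricted map \<open>f\<^sub>1 \<oplus> f\<^sub>2\<close> is undefined.\<close>

lemma eta_mor_in_rep_hom:
  assumes m: "3 \<le> m" and M: "is_rep K (Q m) M" and f: "f \<in> rep_hom K (Q m) M N"
  shows "eta_mor (Suc m) M N f \<in> rep_hom K (Q (Suc m)) (eta_ob M) (eta_ob N)"
proof -
  have "vectorspace K (dsum (rep_space M 1) (rep_space M 2))"
    using M m by (simp add: is_rep_Q_iff vectorspace_dsum)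
  moreover have "oplus_map (f 1) (f 2) \<in> module_hom K (dsum (rep_space M 1) (rep_space M 2))
      (dsum (rep_space N 1) (rep_space N 2))"
    using f m by (intro oplus_map_module_hom rep_hom_module_hom[OF f]) auto
  ultimately have "restrict (oplus_map (f 1) (f 2)) (carrier (dsum (rep_space M 1) (rep_space M 2)))
      \<in> module_hom K (dsum (rep_space M 1) (rep_space M 2)) (dsum (rep_space N 1) (rep_space N 2))"
    by (rule module_hom_cong) simp
  moreover have "eta_mor (Suc m) M N f \<in> extensional {1..Suc m}"
    unfolding eta_mor_def by (rule restrict_extensional)
  moreover have "rep_map M (3, 1) x \<in> carrier (rep_space M 1)" "rep_map M (3, 2) x \<in> carrier (rep_space M 2)"
    if "x \<in> carrier (rep_space M 3)" for x
    using M m that by (auto simp: is_rep_Q_iff intro: module_hom_in_carrier)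
  ultimately show ?thesis
    using f m unfolding rep_hom_Q_iff[OF m] rep_hom_Q_Suc_iff[OF m] Let_def
    by (auto simp: proj_in_carrier oplus_map_def col_map_def)
qed

lemma rep_hom_Q_eqI:
  assumes "3 \<le> m" "f \<in> rep_hom K (Q m) M N" "g \<in> rep_hom K (Q m) M N"
    and "f 1 = g 1" "f 2 = g 2" "\<And>i. 3 \<le> i \<Longrightarrow> i \<le> m \<Longrightarrow> f i = g i"
  shows "f = g"
proof (rule extensionalityI)
  show "f \<in> extensional {1..m}" "g \<in> extensional {1..m}"
    using assms(2,3) by (auto simp: rep_hom_Q_iff[OF assms(1)])
  have "\<forall>i\<in>{1..m}. f i = g i"
    unfolding ball_verts_Q[OF assms(1)] using assms(4-) by auto
  then show "\<And>i. i \<in> {1..m} \<Longrightarrow> f i = g i" by blast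
qed

lemma rep_hom_Q_Suc_eqI:
  assumes "3 \<le> m" "f \<in> rep_hom K (Q (Suc m)) M N" "g \<in> rep_hom K (Q (Suc m)) M N"
    and "f 1 = g 1" "f 2 = g 2" "f 3 = g 3" "\<And>i. 3 \<le> i \<Longrightarrow> i \<le> m \<Longrightarrow> f (Suc i) = g (Suc i)"
  shows "f = g"
proof (rule extensionalityI)
  show "f \<in> extensional {1..Suc m}" "g \<in> extensional {1..Suc m}"
    using assms(2,3) by (auto simp: rep_hom_Q_Suc_iff[OF assms(1)])
  have "\<forall>i\<in>{1..Suc m}. f i = g i"
    unfolding ball_verts_Q_Suc[OF assms(1)] using assms(4-) by auto
  then show "\<And>i. i \<in> {1..Suc m} \<Longrightarrow> f i = g i" by blast
qed

lemma cat_functor_eta: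
  assumes m: "3 \<le> m"
  shows "cat_functor (Rep K (Q m)) (Rep K (Q (Suc m))) (eta (Suc m))"
proof -
  have m': "3 \<le> Suc m" using m by simp
  note wf = wf_digraph_Q[OF m] wf_digraph_Q[OF m']
  note cats = wf[THEN category_Rep]
  show ?thesis
  proof (intro cat_functor.intro cat_functor_axioms.intro cats, goal_cases ob mor Id Comp)
    case (ob M)
    then show ?case using is_rep_eta_ob[OF m] by (simp add: eta_def)
  next
    case (mor M N f)
    then show ?case using eta_mor_in_rep_hom[OF m] by (simp add: eta_def)
  next
    case (Id M)
    then have M: "is_rep K (Q m) M" by simp
    let ?id = "\<lambda>v\<in>verts (Q m). \<lambda>x\<in>carrier (rep_space M v). x"
    let ?id' = "\<lambda>v\<in>verts (Q (Suc m)). \<lambda>x\<in>carrier (rep_space (eta_ob M) v). x"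
    have "eta_mor (Suc m) M M ?id = ?id'"
    proof (rule rep_hom_Q_Suc_eqI[OF m])
      show "eta_mor (Suc m) M M ?id \<in> rep_hom K (Q (Suc m)) (eta_ob M) (eta_ob M)"
        by (rule eta_mor_in_rep_hom[OF m M rep_hom_Id[OF wf(1) M]])
      show "?id' \<in> rep_hom K (Q (Suc m)) (eta_ob M) (eta_ob M)"
        by (rule rep_hom_Id[OF wf(2) is_rep_eta_ob[OF m M]])
    qed (use m in \<open>auto simp: oplus_map_def proj_in_carrier intro!: restrict_ext\<close>)
    then show ?case by (simp add: eta_def)
  next
    case (Comp L M N f g)
    then have reps: "is_rep K (Q m) L" "is_rep K (Q m) M" "is_rep K (Q m) N"
      and f: "f \<in> rep_hom K (Q m) L M" and g: "g \<in> rep_hom K (Q m) M N"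
      by auto
    let ?c = "\<lambda>v\<in>verts (Q m). compose (carrier (rep_space L v)) (g v) (f v)"
    let ?c' = "\<lambda>v\<in>verts (Q (Suc m)). compose (carrier (rep_space (eta_ob L) v))
      (eta_mor (Suc m) M N g v) (eta_mor (Suc m) L M f v)"
    have "eta_mor (Suc m) L N ?c = ?c'"
    proof (rule rep_hom_Q_Suc_eqI[OF m])
      show "eta_mor (Suc m) L N ?c \<in> rep_hom K (Q (Suc m)) (eta_ob L) (eta_ob N)"
        by (rule eta_mor_in_rep_hom[OF m reps(1) rep_hom_Comp[OF wf(1) reps(1) f g]])
      show "?c' \<in> rep_hom K (Q (Suc m)) (eta_ob L) (eta_ob N)"
        by (rule rep_hom_Comp[OF wf(2) is_rep_eta_ob[OF m reps(1)]
              eta_mor_in_rep_hom[OF m reps(1) f] eta_mor_in_rep_hom[OF m reps(2) g]])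
      have "f 1 x \<in> carrier (rep_space M 1)" if "x \<in> carrier (rep_space L 1)" for x
        using rep_hom_in_carrier[OF f _ that] m by simp
      moreover have "f 2 x \<in> carrier (rep_space M 2)" if "x \<in> carrier (rep_space L 2)" for x
        using rep_hom_in_carrier[OF f _ that] m by simp
      ultimately show "eta_mor (Suc m) L N ?c 3 = ?c' 3"
        using m by (auto simp: oplus_map_def proj_in_carrier compose_def intro!: restrict_ext)
    qed (use m in auto)
    then show ?case by (simp add: eta_def)
  qed
qed

text \<open>Faithfulness is clear, as every component of \<open>f\<close> occurs in \<open>\<eta> f\<close>. For
  fullness, a vector of a direct sum is determined by its two projections; compatibility of
  \<open>g\<close> with the projections therefore forces \<open>g\<^sub>3 = g\<^sub>1 \<oplus> g\<^sub>2\<close>, and \<open>g\<close>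
  is \<open>\<eta>\<close> of the family obtained by dropping \<open>g\<^sub>3\<close>.\<close>

lemma fully_faithful_eta:
  fixes K :: "('k, 'r) ring_scheme"
  assumes m: "3 \<le> m"
  shows "fully_faithful (Rep K (Q m) :: ('k, 'u) RepQ) (Rep K (Q (Suc m))) (eta (Suc m))"
proof -
  have "bij_betw (eta_mor (Suc m) M N) (rep_hom K (Q m) M N) (rep_hom K (Q (Suc m)) (eta_ob M) (eta_ob N))"
    if M: "is_rep K (Q m) M" and N: "is_rep K (Q m) N" for M N :: "('k, 'u) Qrep"
  proof (rule bij_betw_imageI)
    show "inj_on (eta_mor (Suc m) M N) (rep_hom K (Q m) M N)"
    proof (rule inj_onI)
      fix f g assume f: "f \<in> rep_hom K (Q m) M N" and g: "g \<in> rep_hom K (Q m) M N"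
        and eq: "eta_mor (Suc m) M N f = eta_mor (Suc m) M N g"
      show "f = g"
      proof (rule rep_hom_Q_eqI[OF m f g])
        show "f 1 = g 1" using fun_cong[OF eq, of 1] m by simp
        show "f 2 = g 2" using fun_cong[OF eq, of 2] m by simp
        show "f i = g i" if "3 \<le> i" "i \<le> m" for i
          using fun_cong[OF eq, of "Suc i"] that m by simp
      qed
    qed
    have "\<exists>f\<in>rep_hom K (Q m) M N. eta_mor (Suc m) M N f = g"
      if g: "g \<in> rep_hom K (Q (Suc m)) (eta_ob M) (eta_ob N)" for g
    proof -
      define f where "f = (\<lambda>i\<in>{1..m}. if i \<le> 2 then g i else g (Suc i))"
      have f_simps: "f 1 = g 1" "f (Suc 0) = g 1" "f 2 = g 2" "f 3 = g 4" "\<And>i. 3 \<le> i \<Longrightarrow> i \<le> m \<Longrightarrow> f i = g (Suc i)"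
        using m unfolding f_def by auto
      have g3_in: "g 3 z \<in> carrier (dsum (rep_space N 1) (rep_space N 2))"
        if "z \<in> carrier (dsum (rep_space M 1) (rep_space M 2))" for z
        using rep_hom_in_carrier[OF g, of 3 z] that m by simp
      have pr: "g 1 (proj1 z) = proj1 (g 3 z)" "g 2 (proj2 z) = proj2 (g 3 z)"
        if "z \<in> carrier (dsum (rep_space M 1) (rep_space M 2))" for z
        using g that m unfolding rep_hom_Q_Suc_iff[OF m] by auto
      have g3: "g 3 z = oplus_map (g 1) (g 2) z"
        if z: "z \<in> carrier (dsum (rep_space M 1) (rep_space M 2))" for z
        using Tup_proj[OF g3_in[OF z]] pr[OF z] by (simp add: oplus_map_def)
      have "f \<in> extensional {1..m}"
        unfolding f_def by (rule restrict_extensional)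
      moreover have "g 1 (rep_map M (3, 1) x) = rep_map N (3, 1) (g 4 x) \<and>
          g 2 (rep_map M (3, 2) x) = rep_map N (3, 2) (g 4 x)" if x: "x \<in> carrier (rep_space M 3)" for x
      proof -
        have "rep_map M (3, 1) x \<in> carrier (rep_space M 1)" "rep_map M (3, 2) x \<in> carrier (rep_space M 2)"
          using M m x by (auto simp: is_rep_Q_iff intro: module_hom_in_carrier)
        moreover have "g 3 (col_map (rep_map M (3, 1)) (rep_map M (3, 2)) x) =
            col_map (rep_map N (3, 1)) (rep_map N (3, 2)) (g 4 x)"
          using g x m unfolding rep_hom_Q_Suc_iff[OF m] by auto
        ultimately show ?thesis
          using g3[of "col_map (rep_map M (3, 1)) (rep_map M (3, 2)) x"]
          by (simp add: col_map_def oplus_map_def)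
      qed
      ultimately have f: "f \<in> rep_hom K (Q m) M N"
        using g m unfolding rep_hom_Q_iff[OF m] rep_hom_Q_Suc_iff[OF m] Let_def
        by (simp add: f_simps)
      have "eta_mor (Suc m) M N f = g"
      proof (rule rep_hom_Q_Suc_eqI[OF m eta_mor_in_rep_hom[OF m M f] g])
        have "g 3 \<in> extensional (carrier (dsum (rep_space M 1) (rep_space M 2)))"
          using g m unfolding rep_hom_Q_Suc_iff[OF m] Let_def by simp
        then show "eta_mor (Suc m) M N f 3 = g 3"
          using m g3 by (intro extensionalityI[of _ "carrier (dsum (rep_space M 1) (rep_space M 2))"])
            (simp_all add: f_simps)
      qed (use m f_simps in auto)
      with f show ?thesis by blast
    qed
    then show "eta_mor (Suc m) M N ` rep_hom K (Q m) M N = rep_hom K (Q (Suc m)) (eta_ob M) (eta_ob N)"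
      using eta_mor_in_rep_hom[OF m M] by blast
  qed
  then show ?thesis
    unfolding fully_faithful_def by (simp add: eta_def)
qed


section \<open>The essential image of \<open>\<eta>\<close>\<close>

text \<open>Removing vertex 3 replaces each path \<open>4 \<rightarrow> 3 \<rightarrow> j\<close>, for \<open>j = 1, 2\<close>, by
  its composite. The composites belong to the arrows \<open>(3, 1)\<close> and \<open>(3, 2)\<close>
  of \<open>Q m\<close>, which are those ending in a vertex \<open>j \<le> 2\<close>.\<close>

definition contract :: "('k, 'u) Qrep \<Rightarrow> ('k, 'u) Qrep" where
  "contract M =
     \<lparr>rep_space = (\<lambda>i. if i \<le> 2 then rep_space M i else rep_space M (Suc i)),
      rep_map = (\<lambda>(i, j).
        if j \<le> 2 then (\<lambda>x. rep_map M (3, j) (rep_map M (4, 3) x))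
        else rep_map M (Suc i, Suc j))\<rparr>"

lemma contract_simps [simp]:
  "rep_space (contract M) (Suc 0) = rep_space M 1"
  "rep_space (contract M) 2 = rep_space M 2"
  "rep_space (contract M) 3 = rep_space M 4"
  "3 \<le> i \<Longrightarrow> rep_space (contract M) i = rep_space M (Suc i)"
  "rep_map (contract M) (3, Suc 0) = (\<lambda>x. rep_map M (3, 1) (rep_map M (4, 3) x))"
  "rep_map (contract M) (3, 2) = (\<lambda>x. rep_map M (3, 2) (rep_map M (4, 3) x))"
  "3 \<le> i \<Longrightarrow> rep_map (contract M) (Suc i, i) = rep_map M (Suc (Suc i), Suc i)"
  unfolding contract_def by auto

lemma is_rep_contract:
  assumes m: "3 \<le> m" and M: "is_rep K (Q (Suc m)) M"
  shows "is_rep K (Q m) (contract M)"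
  using M unfolding is_rep_Q_iff[OF m] is_rep_Q_Suc_iff[OF m]
  by (auto intro: module_hom_comp)

text \<open>The isomorphism is the column map at vertex 3 and the identity elsewhere. It is compatible
  with \<open>4 \<rightarrow> 3\<close> because the column of the composites is the composite with the
  column.\<close>

lemma isomorphic_eta_contract:
  assumes m: "3 \<le> m" and M: "is_rep K (Q (Suc m)) M"
    and bij: "bij_betw (col_map (rep_map M (3, 1)) (rep_map M (3, 2)))
      (carrier (rep_space M 3)) (carrier (dsum (rep_space M 1) (rep_space M 2)))"
  shows "isomorphic (Rep K (Q (Suc m))) M (eta_ob (contract M))"
proof -
  define col where "col = col_map (rep_map M (3, 1)) (rep_map M (3, 2))"
  define h where "h v = (if v = 3 then col else (\<lambda>x. x))" for v :: nat
  let ?f = "\<lambda>v\<in>verts (Q (Suc m)). \<lambda>x\<in>carrier (rep_space M v). h v x"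
  have wf: "wf_digraph (Q (Suc m))"
    using m by (intro wf_digraph_Q) simp
  have hom: "\<forall>v\<in>{1..Suc m}. h v \<in> module_hom K (rep_space M v) (rep_space (eta_ob (contract M)) v)"
    using M m unfolding ball_verts_Q_Suc[OF m] is_rep_Q_Suc_iff[OF m] h_def col_def
    by (simp add: module_hom_id col_map_module_hom)
  have commute: "\<forall>a\<in>arcs (Q (Suc m)). \<forall>x\<in>carrier (rep_space M (fst a)).
      h (snd a) (rep_map M a x) = rep_map (eta_ob (contract M)) a (h (fst a) x)"
    unfolding ball_arcs_Q_Suc[OF m] h_def col_def by (simp add: col_map_def)
  have f: "?f \<in> rep_hom K (Q (Suc m)) M (eta_ob (contract M))"
    by (rule rep_homI[OF wf M]) (use hom commute in auto)
  have "\<forall>v\<in>{1..Suc m}. bij_betw (h v) (carrier (rep_space M v)) (carrier (rep_space (eta_ob (contract M)) v))"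
    using m bij unfolding ball_verts_Q_Suc[OF m] h_def col_def by (simp add: bij_betw_def)
  then have "\<forall>v\<in>verts (Q (Suc m)).
      bij_betw (?f v) (carrier (rep_space M v)) (carrier (rep_space (eta_ob (contract M)) v))"
    by (auto cong: bij_betw_cong)
  then show ?thesis
    unfolding isomorphic_def
    using is_iso_Rep_iff[OF wf M is_rep_eta_ob[OF m is_rep_contract[OF m M]]] f by blast
qed

text \<open>Compatibility of an isomorphism \<open>f : \<eta> M \<rightarrow> N\<close> with the projections says that the
  column map of \<open>N\<close> after \<open>f\<^sub>3\<close> is \<open>f\<^sub>1 \<oplus> f\<^sub>2\<close>. Both \<open>f\<^sub>3\<close> and
  \<open>f\<^sub>1 \<oplus> f\<^sub>2\<close> are bijective, hence so is the column map.\<close>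

lemma bij_col_map_of_isomorphic_eta:
  assumes m: "3 \<le> m" and M: "is_rep K (Q m) M" and N: "is_rep K (Q (Suc m)) N"
    and iso: "isomorphic (Rep K (Q (Suc m))) (eta_ob M) N"
  shows "bij_betw (col_map (rep_map N (3, 1)) (rep_map N (3, 2)))
    (carrier (rep_space N 3)) (carrier (dsum (rep_space N 1) (rep_space N 2)))"
proof -
  have wf: "wf_digraph (Q (Suc m))"
    using m by (intro wf_digraph_Q) simp
  obtain f where f: "f \<in> rep_hom K (Q (Suc m)) (eta_ob M) N"
    and "\<forall>v\<in>{1..Suc m}. bij_betw (f v) (carrier (rep_space (eta_ob M) v)) (carrier (rep_space N v))"
    using iso is_iso_Rep_iff[OF wf is_rep_eta_ob[OF m M] N] unfolding isomorphic_def by auto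
  then have bij: "bij_betw (f 1) (carrier (rep_space M 1)) (carrier (rep_space N 1))"
    "bij_betw (f 2) (carrier (rep_space M 2)) (carrier (rep_space N 2))"
    "bij_betw (f 3) (carrier (dsum (rep_space M 1) (rep_space M 2))) (carrier (rep_space N 3))"
    unfolding ball_verts_Q_Suc[OF m] by auto
  have "oplus_map (f 1) (f 2) z = (col_map (rep_map N (3, 1)) (rep_map N (3, 2)) \<circ> f 3) z"
    if "z \<in> carrier (dsum (rep_space M 1) (rep_space M 2))" for z
    using f that unfolding rep_hom_Q_Suc_iff[OF m] by (auto simp: oplus_map_def col_map_def)
  then have "bij_betw (col_map (rep_map N (3, 1)) (rep_map N (3, 2)) \<circ> f 3)
      (carrier (dsum (rep_space M 1) (rep_space M 2))) (carrier (dsum (rep_space N 1) (rep_space N 2)))"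
    using bij_betw_oplus_map[OF bij(1,2)] bij_betw_cong by blast
  then show ?thesis
    using bij_betw_comp_iff[OF bij(3)] by blast
qed

lemma B_check_eq_essential_image:
  fixes K :: "('k, 'r) ring_scheme"
  assumes m: "3 \<le> m"
  shows "(B_check K (Suc m) :: ('k, 'u) RepQ) = essential_image (Rep K (Q m)) (Rep K (Q (Suc m))) (eta (Suc m))"
proof -
  have "bij_betw (col_map (rep_map M (3, 1)) (rep_map M (3, 2)))
      (carrier (rep_space M 3)) (carrier (dsum (rep_space M 1) (rep_space M 2))) \<longleftrightarrow>
    (\<exists>X. is_rep K (Q m) X \<and> isomorphic (Rep K (Q (Suc m))) (eta_ob X) M)"
    if "is_rep K (Q (Suc m)) M" for M :: "('k, 'u) Qrep"
    using that isomorphic_eta_contract[OF m that, THEN isomorphic_sym] is_rep_contract[OF m that]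
      bij_col_map_of_isomorphic_eta[OF m _ that] by blast
  then show ?thesis
    unfolding B_check_def essential_image_def full_subcategory_def
    by (auto simp: eta_def intro!: arg_cong[where f = "\<lambda>S. Ob_update (\<lambda>_. S) _"])
qed

theorem theorem2p2:
  fixes K :: "('k, 'r) ring_scheme" and n :: nat
  assumes "field K" and "n \<ge> 4"
  shows "equivalent_categories (B_check K n :: ('k, 'u) RepQ) (Rep K (Q (n - 1)) :: ('k, 'u) RepQ)
    \<and> cat_functor (Rep K (Q (n - 1)) :: ('k, 'u) RepQ) (Rep K (Q n)) (eta n)
    \<and> fully_faithful (Rep K (Q (n - 1)) :: ('k, 'u) RepQ) (Rep K (Q n)) (eta n)
    \<and> (B_check K n :: ('k, 'u) RepQ) = essential_image (Rep K (Q (n - 1))) (Rep K (Q n)) (eta n)"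
proof -
  obtain m where n: "n = Suc m" and m: "3 \<le> m"
    using \<open>n \<ge> 4\<close> by (cases n) auto
  interpret eta: cat_functor "Rep K (Q m) :: ('k, 'u) RepQ" "Rep K (Q (Suc m))" "eta (Suc m)"
    by (rule cat_functor_eta[OF m])
  have ff: "fully_faithful (Rep K (Q m) :: ('k, 'u) RepQ) (Rep K (Q (Suc m))) (eta (Suc m))"
    by (rule fully_faithful_eta[OF m])
  have "(B_check K (Suc m) :: ('k, 'u) RepQ) =
      essential_image (Rep K (Q m)) (Rep K (Q (Suc m))) (eta (Suc m))"
    by (rule B_check_eq_essential_image[OF m])
  then show ?thesis
    using eta.fully_faithful_equivalent_essential_image[OF ff] eta.cat_functor_axioms ff
    by (simp add: n)
qed

end
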